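(* Let $A$ be an asymmetric fuzzy number such that $[A]_1=\{a_m\}$, and let $a<b$ be real numbers. If $f:[a,b]\to\mathbb{R}_{\mathcal{F}(A)}$ is an integrable function such that $$\int_a^b f(t)\odot\eta'(t)\,dt=0$$ for every $\eta\in C^1([a,b],\mathbb{R}_{\mathcal{F}(A)})$ with $\eta(a)=\eta(b)=0$, then there exists $u\in\mathbb{R}_{\mathcal{F}(A)}$ such that $f(t)\ominus u\in\mathbb{R}_{\mathcal{F}(A)}^0$ for almost every $t\in[a,b]$.
   Context: A fuzzy subset of $\mathbb{R}$ is a function $A:\mathbb{R}\to[0,1]$; its $\alpha$-levels are $[A]_\alpha=\{x: A(x)\geq\alpha\}$ for $0<\alpha\leq1$ and $[A]_0=\overline{\{x:A(x)>0\}}$. $A$ is a fuzzy number if all its $\alpha$-levels are nonempty closed intervals and $\{x:A(x)>0\}$ is bounded. For $r,q\in\mathbb{R}$, $r+qA$ is the fuzzy number with $[r+qA]_\alpha=\{r+qx: x\in[A]_\alpha\}$ for every $\alpha\in[0,1]$; $r+0A$ is identified with the real number $r$. $A$ is asymmetric if for every $x\in\mathbb{R}$ there exists $y\in\mathbb{R}$ with $A(x-y)\neq A(x+y)$. Put $\mathbb{R}_{\mathcal{F}(A)}=\{r+qA: r,q\in\mathbb{R}\}$. When $A$ is asymmetric, $(r,q)\mapsto r+qA$ is a bijection from $\mathbb{R}^2$ onto $\mathbb{R}_{\mathcal{F}(A)}$, and $\mathbb{R}_{\mathcal{F}(A)}$ is a 2-dimensional real vector space with $(r_B+q_BA)\oplus(r_C+q_CA)=(r_B+r_C)+(q_B+q_C)A$,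 $\lambda(r+qA)=\lambda r+(\lambda q)A$ and $B\ominus C=B\oplus(-1)C$, normed by $\|r+qA\|=|q|+|r+qa_m|$. $\Psi$-cross product (for $[A]_1=\{a_m\}$): for $B=r_B+q_BA$, $C=r_C+q_CA$ with $[B]_1=\{b\}$, $[C]_1=\{c\}$, $B\odot C=cB+bC-bc$ (sum in the vector space $\mathbb{R}_{\mathcal{F}(A)}$ with addition $\oplus$, i.e. $B\odot C=cB\oplus bC\oplus(-bc)$), equivalently $B\odot C=(r_Br_C-a_m^2q_Bq_C)+(r_Bq_C+r_Cq_B+2a_mq_Bq_C)A$. Also $B^2=B\odot B$ and $\mathbb{R}_{\mathcal{F}(A)}^0=\{B: B^2=0\}=\{r+qA: r+qa_m=0\}$. Integrability is Riemann integrability in the Banach space $\mathbb{R}_{\mathcal{F}(A)}$; $f=r(\cdot)+q(\cdot)A$ is integrable iff $r,q$ are Riemann integrable, and then $\int_a^b f=\int_a^b r+\left(\int_a^b q\right)A$. Derivatives are taken in the normed space and equal the componentwise derivatives. $C^1([a,b],\mathbb{R}_{\mathcal{F}(A)})$ is the set of continuously differentiable functions on $[a,b]$ (one-sided derivatives at endpoints). "Almost every" refers to Lebesgue measure. *)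

theory Defs
  imports "HOL-Analysis.Analysis"
begin

section \<open>Fuzzy numbers\<close>

type_synonym fuzzy = "real \<Rightarrow> real"

definition fuzzy_subset :: "fuzzy \<Rightarrow> bool" where
  "fuzzy_subset A \<longleftrightarrow> (\<forall>x. 0 \<le> A x \<and> A x \<le> 1)"

text \<open>Only meaningful for \<open>\<alpha> \<in> {0..1}\<close>.\<close>

definition level :: "fuzzy \<Rightarrow> real \<Rightarrow> real set" where
  "level A \<alpha> = (if \<alpha> = 0 then closure {x. A x > 0} else {x. A x \<ge> \<alpha>})"

definition fuzzy_number :: "fuzzy \<Rightarrow> bool" where
  "fuzzy_number A \<longleftrightarrow>
     fuzzy_subset A \<and>
     (\<forall>\<alpha>\<in>{0..1}. level A \<alpha> \<noteq> {} \<and> closed (level A \<alpha>) \<and> is_interval (level A \<alpha>)) \<and>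
     bounded {x. A x > 0}"

definition asymmetric :: "fuzzy \<Rightarrow> bool" where
  "asymmetric A \<longleftrightarrow> (\<forall>x. \<exists>y. A (x - y) \<noteq> A (x + y))"

text \<open>\<open>core B\<close> is the number \<open>b\<close> with \<open>[B]\<^sub>1 = {b}\<close>, when the 1-level is a singleton.\<close>

definition core :: "fuzzy \<Rightarrow> real" where
  "core B = (THE b. level B 1 = {b})"

section \<open>The space of the fuzzy numbers \<open>r + qA\<close>\<close>

text \<open>\<open>lin A r q\<close> is \<open>r + qA\<close>. See \<open>lin_unique\<close> below for existence and uniqueness.\<close>

definition lin :: "fuzzy \<Rightarrow> real \<Rightarrow> real \<Rightarrow> fuzzy" where
  "lin A r q =
     (THE B. fuzzy_number B \<and> (\<forall>\<alpha>\<in>{0..1}. level B \<alpha> = (\<lambda>x. r + q * x) ` level A \<alpha>))"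

text \<open>The real number \<open>r\<close>, identified with \<open>r + 0A\<close>.\<close>

abbreviation crisp :: "fuzzy \<Rightarrow> real \<Rightarrow> fuzzy" where
  "crisp A r \<equiv> lin A r 0"

definition RF :: "fuzzy \<Rightarrow> fuzzy set" where
  "RF A = {lin A r q | r q. True}"

text \<open>
  \<open>rpart A B\<close> and \<open>qpart A B\<close> are the coordinates \<open>r, q\<close> of \<open>B = r + qA\<close>. They are
  determined when \<open>A\<close> is an asymmetric fuzzy number and \<open>B \<in> RF A\<close>, see \<open>lin_inject\<close>.
\<close>

definition rpart :: "fuzzy \<Rightarrow> fuzzy \<Rightarrow> real" where
  "rpart A B = (THE r. \<exists>q. B = lin A r q)"

definition qpart :: "fuzzy \<Rightarrow> fuzzy \<Rightarrow> real" where
  "qpart A B = (THE q. \<exists>r. B = lin A r q)"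

definition fadd :: "fuzzy \<Rightarrow> fuzzy \<Rightarrow> fuzzy \<Rightarrow> fuzzy" ("(_ \<oplus>\<^bsub>_\<^esub> _)" [65, 0, 66] 65) where
  "fadd B A C = lin A (rpart A B + rpart A C) (qpart A B + qpart A C)"

definition fscale :: "real \<Rightarrow> fuzzy \<Rightarrow> fuzzy \<Rightarrow> fuzzy" ("(_ \<cdot>\<^bsub>_\<^esub> _)" [75, 0, 76] 75) where
  "fscale c A B = lin A (c * rpart A B) (c * qpart A B)"

definition fminus :: "fuzzy \<Rightarrow> fuzzy \<Rightarrow> fuzzy \<Rightarrow> fuzzy" ("(_ \<ominus>\<^bsub>_\<^esub> _)" [65, 0, 66] 65) where
  "fminus B A C = B \<oplus>\<^bsub>A\<^esub> ((-1) \<cdot>\<^bsub>A\<^esub> C)"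

definition fnorm :: "fuzzy \<Rightarrow> fuzzy \<Rightarrow> real" where
  "fnorm A B = \<bar>qpart A B\<bar> + \<bar>rpart A B + qpart A B * core A\<bar>"

text \<open>The \<open>\<Psi>\<close>-cross product \<open>B \<odot> C = cB + bC - bc\<close> with \<open>[B]\<^sub>1 = {b}\<close> and \<open>[C]\<^sub>1 = {c}\<close>.\<close>

definition cross :: "fuzzy \<Rightarrow> fuzzy \<Rightarrow> fuzzy \<Rightarrow> fuzzy" ("(_ \<odot>\<^bsub>_\<^esub> _)" [70, 0, 71] 70) where
  "cross B A C =
     ((core C \<cdot>\<^bsub>A\<^esub> B) \<oplus>\<^bsub>A\<^esub> (core B \<cdot>\<^bsub>A\<^esub> C)) \<oplus>\<^bsub>A\<^esub> crisp A (- (core B * core C))"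

definition RF0 :: "fuzzy \<Rightarrow> fuzzy set" where
  "RF0 A = {B \<in> RF A. B \<odot>\<^bsub>A\<^esub> B = crisp A 0}"

section \<open>Calculus in the normed space \<open>RF A\<close>\<close>

text \<open>
  \<open>RF A\<close> is a carrier set and not a type, so the type-class notions of sum, limit, derivative
  and integral do not apply; they are spelled out here with the operations and norm above.
  The fold does not depend on the order since addition is commutative and associative.
\<close>

definition riemann_sum :: "fuzzy \<Rightarrow> (real \<Rightarrow> fuzzy) \<Rightarrow> (real \<times> real set) set \<Rightarrow> fuzzy" where
  "riemann_sum A f p =
     Finite_Set.fold (\<lambda>(x, K) S. S \<oplus>\<^bsub>A\<^esub> (measure lborel K \<cdot>\<^bsub>A\<^esub> f x)) (crisp A 0) p"

text \<open>Riemann (not gauge) integral: the mesh bound \<open>d\<close> is a constant.\<close>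

definition has_riemann_integral ::
  "fuzzy \<Rightarrow> real \<Rightarrow> real \<Rightarrow> (real \<Rightarrow> fuzzy) \<Rightarrow> fuzzy \<Rightarrow> bool" where
  "has_riemann_integral A a b f I \<longleftrightarrow>
     I \<in> RF A \<and>
     (\<forall>e>0. \<exists>d>0. \<forall>p. p tagged_division_of {a..b} \<and> (\<forall>(x, K)\<in>p. diameter K < d) \<longrightarrow>
        fnorm A (riemann_sum A f p \<ominus>\<^bsub>A\<^esub> I) < e)"

definition riemann_integrable :: "fuzzy \<Rightarrow> real \<Rightarrow> real \<Rightarrow> (real \<Rightarrow> fuzzy) \<Rightarrow> bool" where
  "riemann_integrable A a b f \<longleftrightarrow> (\<exists>I. has_riemann_integral A a b f I)"

definition fcontinuous_on :: "fuzzy \<Rightarrow> real set \<Rightarrow> (real \<Rightarrow> fuzzy) \<Rightarrow> bool" where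
  "fcontinuous_on A S f \<longleftrightarrow>
     (\<forall>t\<in>S. ((\<lambda>s. fnorm A (f s \<ominus>\<^bsub>A\<^esub> f t)) \<longlongrightarrow> 0) (at t within S))"

definition has_fderiv :: "fuzzy \<Rightarrow> real set \<Rightarrow> (real \<Rightarrow> fuzzy) \<Rightarrow> real \<Rightarrow> fuzzy \<Rightarrow> bool" where
  "has_fderiv A S f t D \<longleftrightarrow>
     D \<in> RF A \<and>
     ((\<lambda>s. fnorm A ((1 / (s - t)) \<cdot>\<^bsub>A\<^esub> (f s \<ominus>\<^bsub>A\<^esub> f t) \<ominus>\<^bsub>A\<^esub> D)) \<longlongrightarrow> 0) (at t within S)"

definition fderiv :: "fuzzy \<Rightarrow> real set \<Rightarrow> (real \<Rightarrow> fuzzy) \<Rightarrow> real \<Rightarrow> fuzzy" where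
  "fderiv A S f t = (THE D. has_fderiv A S f t D)"

definition C1 :: "fuzzy \<Rightarrow> real \<Rightarrow> real \<Rightarrow> (real \<Rightarrow> fuzzy) set" where
  "C1 A a b =
     {f. (\<forall>t\<in>{a..b}. f t \<in> RF A \<and> (\<exists>D. has_fderiv A {a..b} f t D)) \<and>
         fcontinuous_on A {a..b} (fderiv A {a..b} f)}"

section \<open>Well-definedness\<close>

lemma fuzzy_subset_level_eqI:
  assumes "fuzzy_subset B" "fuzzy_subset C"
    and lev: "\<forall>\<alpha>\<in>{0..1}. level B \<alpha> = level C \<alpha>"
  shows "B = C"
proof -
  have le: "B x \<le> C x" if "fuzzy_subset B" "fuzzy_subset C"
    and "\<forall>\<alpha>\<in>{0..1}. level B \<alpha> = level C \<alpha>" for x B C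
  proof (cases "B x = 0")
    case True
    then show ?thesis using that by (simp add: fuzzy_subset_def)
  next
    case False
    with that have "B x \<in> {0..1}" by (simp add: fuzzy_subset_def)
    then have "x \<in> level C (B x)" using that(3) False by (force simp: level_def)
    then show ?thesis using False by (simp add: level_def)
  qed
  show ?thesis
    by (rule ext, rule antisym; rule le) (use assms in auto)
qed

definition lin_fun :: "fuzzy \<Rightarrow> real \<Rightarrow> real \<Rightarrow> fuzzy" where
  "lin_fun A r q z = (if q = 0 then if z = r then 1 else 0 else A ((z - r) / q))"

lemma level_lin_fun:
  assumes A: "fuzzy_number A" and \<alpha>: "\<alpha> \<in> {0..1}"
  shows "level (lin_fun A r q) \<alpha> = (\<lambda>x. r + q * x) ` level A \<alpha>"
proof (cases "q = 0")
  case True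
  have "level A \<alpha> \<noteq> {}" using A \<alpha> by (simp add: fuzzy_number_def)
  moreover have "level (lin_fun A r q) \<alpha> = {r}"
  proof (cases "\<alpha> = 0")
    case True
    have "{x. lin_fun A r q x > 0} = {r}" using \<open>q = 0\<close> by (auto simp: lin_fun_def)
    then show ?thesis using True by (simp add: level_def)
  next
    case False
    then show ?thesis using \<open>q = 0\<close> \<alpha> by (auto simp: level_def lin_fun_def split: if_splits)
  qed
  ultimately show ?thesis using True by auto
next
  case False
  have img: "{z. P ((z - r) / q)} = (\<lambda>x. r + q * x) ` {x. P x}" for P
  proof (intro subset_antisym subsetI)
    fix z assume "z \<in> {z. P ((z - r) / q)}"
    moreover have "z = r + q * ((z - r) / q)" using False by simp
    ultimately show "z \<in> (\<lambda>x. r + q * x) ` {x. P x}" by blast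
  qed (use False in auto)
  have aff: "(\<lambda>x. r + q * x) ` S = (+) r ` ((*\<^sub>R) q ` S)" for S :: "real set"
    by (simp add: image_image)
  have "closure ((\<lambda>x. r + q * x) ` S) = (\<lambda>x. r + q * x) ` closure S" for S
    unfolding aff closure_translation closure_scaleR ..
  then show ?thesis
    using False by (simp add: level_def lin_fun_def img[of "\<lambda>x. 0 < A x"] img[of "\<lambda>x. \<alpha> \<le> A x"])
qed

lemma fuzzy_number_lin_fun:
  assumes A: "fuzzy_number A"
  shows "fuzzy_number (lin_fun A r q)"
proof -
  have "fuzzy_subset (lin_fun A r q)"
    using A by (simp add: fuzzy_number_def fuzzy_subset_def lin_fun_def)
  moreover have "bounded {x. lin_fun A r q x > 0}"
  proof -
    have "compact (level A 0)"
      using A by (simp add: fuzzy_number_def level_def compact_closure)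
    then have "compact (level (lin_fun A r q) 0)"
      by (subst level_lin_fun[OF A]) (auto intro!: compact_continuous_image continuous_intros)
    then have "bounded (closure {x. lin_fun A r q x > 0})"
      by (simp add: level_def compact_imp_bounded)
    then show ?thesis using bounded_subset closure_subset by blast
  qed
  moreover have "level (lin_fun A r q) \<alpha> \<noteq> {} \<and> closed (level (lin_fun A r q) \<alpha>)
      \<and> is_interval (level (lin_fun A r q) \<alpha>)" if \<alpha>: "\<alpha> \<in> {0..1}" for \<alpha>
  proof -
    have L: "level A \<alpha> \<noteq> {}" "closed (level A \<alpha>)" "is_interval (level A \<alpha>)"
      using A \<alpha> by (auto simp: fuzzy_number_def)
    have "(\<lambda>x. r + q * x) ` level A \<alpha> = (+) r ` ((*\<^sub>R) q ` level A \<alpha>)"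
      by (simp add: image_image)
    then have "closed ((\<lambda>x. r + q * x) ` level A \<alpha>)"
      using L by (metis closed_scaling closed_translation)
    moreover have "connected ((\<lambda>x. r + q * x) ` level A \<alpha>)"
      using L by (intro connected_continuous_image continuous_intros) (simp add: is_interval_connected)
    ultimately show ?thesis
      using L by (simp add: level_lin_fun[OF A \<alpha>] is_interval_connected_1)
  qed
  ultimately show ?thesis by (simp add: fuzzy_number_def)
qed

lemma lin_unique:
  assumes "fuzzy_number A"
  shows "\<exists>!B. fuzzy_number B \<and> (\<forall>\<alpha>\<in>{0..1}. level B \<alpha> = (\<lambda>x. r + q * x) ` level A \<alpha>)"
proof (rule ex1I[of _ "lin_fun A r q"])
  show "fuzzy_number (lin_fun A r q) \<and>
      (\<forall>\<alpha>\<in>{0..1}. level (lin_fun A r q) \<alpha> = (\<lambda>x. r + q * x) ` level A \<alpha>)"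
    using assms by (simp add: fuzzy_number_lin_fun level_lin_fun)
next
  fix B
  assume "fuzzy_number B \<and> (\<forall>\<alpha>\<in>{0..1}. level B \<alpha> = (\<lambda>x. r + q * x) ` level A \<alpha>)"
  then show "B = lin_fun A r q"
    using assms fuzzy_number_lin_fun[OF assms, of r q]
    by (intro fuzzy_subset_level_eqI) (auto simp: fuzzy_number_def level_lin_fun)
qed

lemma lin_eq: "fuzzy_number A \<Longrightarrow> lin A r q = lin_fun A r q"
  unfolding lin_def
  by (rule the1_equality[OF lin_unique]) (auto simp: fuzzy_number_lin_fun level_lin_fun)

lemma level_lin:
  "\<lbrakk>fuzzy_number A; \<alpha> \<in> {0..1}\<rbrakk> \<Longrightarrow> level (lin A r q) \<alpha> = (\<lambda>x. r + q * x) ` level A \<alpha>"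
  by (simp add: lin_eq level_lin_fun)

lemma core_lin:
  assumes "fuzzy_number A" "level A 1 = {m}"
  shows "core (lin A r q) = r + q * m"
  using assms by (simp add: core_def level_lin)

lemma lin_inject:
  assumes A: "fuzzy_number A" and asym: "asymmetric A"
  shows "lin A r q = lin A r' q' \<longleftrightarrow> r = r' \<and> q = q'"
proof
  assume eq: "lin A r q = lin A r' q'"
  have c: "level A 0 \<noteq> {}" "is_interval (level A 0)"
    using A by (auto simp: fuzzy_number_def)
  moreover have "compact (level A 0)"
    using A by (simp add: fuzzy_number_def level_def compact_closure)
  ultimately obtain l u where lu: "level A 0 = {l..u}"
    by (metis connected_compact_interval_1 is_interval_connected_1)
  have "l \<le> u" using c(1) lu by simp
  have zero: "A x = 0" if "x \<notin> {l..u}" for x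
  proof -
    have "\<not> A x > 0"
      using that lu closure_subset[of "{x. A x > 0}"] by (auto simp: level_def)
    then show ?thesis
      using A by (metis fuzzy_number_def fuzzy_subset_def less_eq_real_def)
  qed
  have "l < u"
  proof (rule ccontr)
    assume "\<not> l < u"
    then have "A (l - y) = A (l + y)" for y
      by (cases "y = 0") (use zero in auto)
    then show False using asym by (auto simp: asymmetric_def)
  qed
  have im: "(\<lambda>x. r + q * x) ` {l..u} = (\<lambda>x. r' + q' * x) ` {l..u}"
    using eq level_lin[OF A, of 0 r q] level_lin[OF A, of 0 r' q'] lu by simp
  have aff: "(\<lambda>x. r + q * x) ` {l..u} =
      (if 0 \<le> q then {r + q * l..r + q * u} else {r + q * u..r + q * l})" for r q
    using image_affinity_atLeastAtMost[of q r l u] \<open>l \<le> u\<close> by (simp add: add.commute)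
  have ord: "q * l \<le> q * u \<longleftrightarrow> 0 \<le> q" for q
    using \<open>l < u\<close> by (auto simp: mult_le_cancel_left)
  have cases: "(r + q * l = r' + q' * l \<and> r + q * u = r' + q' * u) \<or>
      (r + q * l = r' + q' * u \<and> r + q * u = r' + q' * l)"
    using im unfolding aff
    using ord[of q] ord[of q'] by (auto simp: Icc_eq_Icc split: if_splits)
  then show "r = r' \<and> q = q'"
  proof
    assume *: "r + q * l = r' + q' * l \<and> r + q * u = r' + q' * u"
    then have "(q - q') * (u - l) = 0" by (simp add: algebra_simps)
    then show ?thesis using * \<open>l < u\<close> by simp
  next
    assume *: "r + q * l = r' + q' * u \<and> r + q * u = r' + q' * l"
    then have "(q + q') * (u - l) = 0" by (simp add: algebra_simps)
    then have q': "q' = - q" using \<open>l < u\<close> by simp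
    show ?thesis
    proof (cases "q = 0")
      case True
      then show ?thesis using * q' by simp
    next
      case False
      have sym: "A ((z - r) / q) = A ((z - r') / - q)" for z
        using fun_cong[OF eq, of z] False q' by (simp add: lin_eq[OF A] lin_fun_def)
      define x where "x = (r' - r) / (2 * q)"
      have "A (x - y) = A (x + y)" for y
      proof -
        have "(r + q * (x - y) - r) / q = x - y" "(r + q * (x - y) - r') / - q = x + y"
          using False by (auto simp: x_def field_simps)
        then show ?thesis using sym[of "r + q * (x - y)"] by simp
      qed
      then show ?thesis using asym by (auto simp: asymmetric_def)
    qed
  qed
qed simp

lemma rpart_lin: "\<lbrakk>fuzzy_number A; asymmetric A\<rbrakk> \<Longrightarrow> rpart A (lin A r q) = r"
  by (simp add: rpart_def lin_inject)

lemma qpart_lin: "\<lbrakk>fuzzy_number A; asymmetric A\<rbrakk> \<Longrightarrow> qpart A (lin A r q) = q"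
  by (simp add: qpart_def lin_inject)

lemma cross_lin:
  assumes "fuzzy_number A" "asymmetric A" "level A 1 = {m}"
  shows "lin A r q \<odot>\<^bsub>A\<^esub> lin A r' q' =
    lin A (r * r' - m\<^sup>2 * q * q') (r * q' + r' * q + 2 * m * q * q')"
  using assms
  by (simp add: cross_def fadd_def fscale_def rpart_lin qpart_lin core_lin lin_inject)
     (simp add: algebra_simps power2_eq_square)

lemma riemann_sum_eq:
  assumes A: "fuzzy_number A" "asymmetric A" and "finite p"
  shows "riemann_sum A f p =
    lin A (\<Sum>(x, K)\<in>p. measure lborel K * rpart A (f x)) (\<Sum>(x, K)\<in>p. measure lborel K * qpart A (f x))"
proof -
  define g where "g = (\<lambda>(x, K :: real set) S. S \<oplus>\<^bsub>A\<^esub> (measure lborel K \<cdot>\<^bsub>A\<^esub> f x))"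
  interpret comp_fun_commute g
    by unfold_locales
      (auto simp: g_def fun_eq_iff fadd_def fscale_def rpart_lin[OF A] qpart_lin[OF A] algebra_simps)
  have g: "g (x, K) S = S \<oplus>\<^bsub>A\<^esub> (measure lborel K \<cdot>\<^bsub>A\<^esub> f x)" for x K S
    by (simp add: g_def)
  have "Finite_Set.fold g (crisp A 0) p =
    lin A (\<Sum>(x, K)\<in>p. measure lborel K * rpart A (f x)) (\<Sum>(x, K)\<in>p. measure lborel K * qpart A (f x))"
    using \<open>finite p\<close>
  proof induction
    case (insert y F)
    then show ?case
      by (cases y)
        (simp add: g fadd_def fscale_def rpart_lin[OF A] qpart_lin[OF A] add.commute)
  qed simp
  then show ?thesis by (simp add: riemann_sum_def g_def)
qed

end

theory Submission
  imports Defs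
begin

text \<open>
  The theorem is the classical lemma of du Bois-Reymond, applied to the real function
  \<open>core \<circ> f\<close>. The map \<open>core\<close>, which sends \<open>r + qA\<close> to \<open>r + q a\<^sub>m\<close>, is linear on \<open>RF A\<close>, is
  multiplicative for \<open>\<odot>\<close>, and satisfies \<open>\<bar>core B\<bar> \<le> \<parallel>B\<parallel>\<close>. Hence it commutes with Riemann
  integrals (\<open>has_integral_core\<close>). Moreover \<open>B \<odot> B = 0\<close> holds exactly when \<open>core B = 0\<close>
  (\<open>mem_RF0_iff\<close>), so \<open>RF0 A\<close> is the kernel of \<open>core\<close>, and the conclusion says precisely that
  \<open>core \<circ> f\<close> is almost everywhere constant.

  It is enough to test \<open>f\<close> against real-valued functions \<open>\<eta>\<close>. A continuous \<open>\<psi>\<close> of mean zero on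
  \<open>{a..b}\<close> is the derivative of the crisp function \<open>\<eta> t = \<integral>\<^sub>a\<^sup>t \<psi>\<close>, which vanishes at \<open>a\<close> and \<open>b\<close>.
  Applying \<open>core\<close> to the hypothesis for this \<open>\<eta>\<close> gives \<open>\<integral> core (f t) * \<psi> t dt = 0\<close>.

  The real lemma (\<open>du_Bois_Reymond\<close>) holds for every gauge integrable \<open>h\<close>. After subtraction of
  its mean, \<open>h\<close> becomes a function \<open>g\<close> that is orthogonal to all continuous functions. Testing
  against a steep continuous ramp, the second mean value theorem produces zeros of
  \<open>x \<mapsto> \<integral>\<^sub>x\<^sup>b g\<close> in every interval. This function is continuous, so it vanishes identically, and
  differentiation of the indefinite integral gives \<open>g = 0\<close> almost everywhere.
\<close>

section \<open>The lemma of du Bois-Reymond for gauge integrable functions\<close>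

text \<open>
  All integrals of \<open>g\<close> over subintervals vanish, and almost everywhere \<open>g x\<close> is the limit of the
  mean values of \<open>g\<close> over short intervals to the right of \<open>x\<close>.
\<close>

lemma negligible_nonzero_if_tail_integrals_zero:
  fixes g :: "real \<Rightarrow> real"
  assumes g: "g integrable_on {a..b}"
    and tail: "\<And>x. x \<in> {a..b} \<Longrightarrow> integral {x..b} g = 0"
  shows "negligible {x \<in> {a..b}. g x \<noteq> 0}"
proof -
  \<comment> \<open>The extension by zero is integrable on every interval, as differentiation of the
    indefinite integral requires.\<close>
  define g0 where "g0 x = (if x \<in> {a..b} then g x else 0)" for x
  have sub: "(g has_integral 0) {x..y}" if "x \<in> {a..b}" "y \<in> {a..b}" for x y
  proof (cases "x \<le> y")
    case True
    have gx: "g integrable_on {x..b}"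
      by (rule integrable_on_subinterval[OF g]) (use that in auto)
    have "integral {x..y} g + integral {y..b} g = integral {x..b} g"
      using True that by (intro Henstock_Kurzweil_Integration.integral_combine gx) auto
    then have "integral {x..y} g = 0" using tail that by simp
    moreover have "g integrable_on {x..y}"
      by (rule integrable_on_subinterval[OF g]) (use that in auto)
    ultimately show ?thesis by (metis integrable_integral)
  qed auto
  have g0: "(g0 has_integral 0) {x..y}" for x y
  proof -
    have "(g has_integral 0) ({a..b} \<inter> {x..y})"
    proof (cases "a \<le> b \<and> max a x \<le> min b y")
      case True
      then show ?thesis using sub[of "max a x" "min b y"] by (simp add: Int_atLeastAtMost)
    next
      case False
      then have "{a..b} \<inter> {x..y} = {}" by auto
      then show ?thesis by simp
    qed
    then show ?thesis
      unfolding g0_def by (subst has_integral_restrict_Int) (simp add: Int_commute)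
  qed
  have "g0 integrable_on cbox x y" for x y
    using g0 by (auto simp: integrable_on_def)
  then obtain N where N: "negligible N"
    and lim: "\<And>x e. \<lbrakk>x \<notin> N; 0 < e\<rbrakk> \<Longrightarrow> \<exists>d>0. \<forall>h. 0 < h \<and> h < d \<longrightarrow>
       norm (integral (cbox x (x + h *\<^sub>R One)) g0 /\<^sub>R h ^ DIM(real) - g0 x) < e"
    by (rule integrable_ccontinuous_explicit[of g0]) (rule that)
  have "g0 x = 0" if x: "x \<notin> N" for x
  proof (rule ccontr)
    assume "g0 x \<noteq> 0"
    then obtain d where "d > 0"
      and d: "\<And>h. 0 < h \<Longrightarrow> h < d \<Longrightarrow>
        norm (integral (cbox x (x + h *\<^sub>R One)) g0 /\<^sub>R h ^ DIM(real) - g0 x) < \<bar>g0 x\<bar>"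
      using lim[OF x, of "\<bar>g0 x\<bar>"] by auto
    have "integral (cbox x (x + (d/2) *\<^sub>R One)) g0 = 0"
      using g0 by (metis box_real(2) integral_unique)
    then show False using d[of "d/2"] \<open>d > 0\<close> by simp
  qed
  then have "{x \<in> {a..b}. g x \<noteq> 0} \<subseteq> N" by (force simp: g0_def)
  then show ?thesis using N negligible_subset by blast
qed

text \<open>
  The second mean value theorem transfers orthogonality from ramps to indicators of tails
  \<open>{c..b}\<close> with \<open>c\<close> in the sloping part. That part can be placed anywhere and made arbitrarily
  short, so the zeros of the continuous function \<open>x \<mapsto> \<integral>\<^sub>x\<^sup>b g\<close> are dense in \<open>{a..b}\<close>.
\<close>

lemma negligible_nonzero_if_orthogonal_to_continuous:
  fixes g :: "real \<Rightarrow> real"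
  assumes g: "g integrable_on {a..b}"
    and orth: "\<And>\<psi>. continuous_on {a..b} \<psi> \<Longrightarrow> ((\<lambda>t. \<psi> t * g t) has_integral 0) {a..b}"
  shows "negligible {x \<in> {a..b}. g x \<noteq> 0}"
proof (rule negligible_nonzero_if_tail_integrals_zero[OF g])
  have sub: "g integrable_on {x..y}" if "a \<le> x" "y \<le> b" for x y
    by (rule integrable_on_subinterval[OF g]) (use that in auto)
  have zero_between: "\<exists>c\<in>{x..y}. integral {c..b} g = 0" if xy: "a \<le> x" "x < y" "y \<le> b" for x y
  proof -
    \<comment> \<open>The ramp vanishes up to \<open>x\<close>, is affine on \<open>{x..y}\<close>, and equals 1 from \<open>y\<close> on.\<close>
    define \<psi> where "\<psi> t = max 0 (min 1 ((t - x) / (y - x)))" for t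
    have "continuous_on {a..b} \<psi>"
      unfolding \<psi>_def by (intro continuous_intros) (use xy in auto)
    from orth[OF this] have total: "((\<lambda>t. \<psi> t * g t) has_integral 0) {a..b}" .
    have mono: "\<psi> s \<le> \<psi> t" if "s \<le> t" for s t
    proof -
      have "(s - x) / (y - x) \<le> (t - x) / (y - x)"
        using that xy by (intro divide_right_mono) auto
      then show ?thesis unfolding \<psi>_def by linarith
    qed
    have \<psi>x: "\<psi> t = 0" if "t \<le> x" for t
    proof -
      have "(t - x) / (y - x) \<le> 0" using that xy by (intro divide_nonpos_pos) auto
      then show ?thesis unfolding \<psi>_def by linarith
    qed
    have \<psi>y: "\<psi> t = 1" if "y \<le> t" for t
    proof -
      have "(t - x) / (y - x) \<ge> 1" using that xy by simp
      then show ?thesis unfolding \<psi>_def by linarith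
    qed
    obtain c where c: "c \<in> {x..y}"
      and "((\<lambda>t. \<psi> t * g t) has_integral \<psi> x * integral {x..c} g + \<psi> y * integral {c..y} g) {x..y}"
      using second_mean_value_theorem_full[of g x y \<psi>] sub[of x y] xy mono by auto
    then have mid: "((\<lambda>t. \<psi> t * g t) has_integral integral {c..y} g) {x..y}"
      by (simp add: \<psi>x \<psi>y)
    have left: "((\<lambda>t. \<psi> t * g t) has_integral 0) {a..x}"
      by (rule has_integral_is_0) (simp add: \<psi>x)
    have right: "((\<lambda>t. \<psi> t * g t) has_integral integral {y..b} g) {y..b}"
      using sub[of y b] xy
      by (intro has_integral_eq[OF _ integrable_integral]) (auto simp: \<psi>y)
    have "((\<lambda>t. \<psi> t * g t) has_integral 0 + integral {c..y} g + integral {y..b} g) {a..b}"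
      using xy
      by (intro has_integral_combine[OF _ _ has_integral_combine[OF _ _ left mid] right]) auto
    then have "0 + integral {c..y} g + integral {y..b} g = 0"
      using total by (rule has_integral_unique)
    moreover have "integral {c..y} g + integral {y..b} g = integral {c..b} g"
      using c xy by (intro Henstock_Kurzweil_Integration.integral_combine sub) auto
    ultimately show ?thesis using c by auto
  qed
  have cont: "continuous_on {a..b} (\<lambda>x. integral {x..b} g)"
    by (rule indefinite_integral_continuous_1'[OF g])
  fix x assume x: "x \<in> {a..b}"
  show "integral {x..b} g = 0"
  proof (rule ccontr)
    assume nz: "integral {x..b} g \<noteq> 0"
    then have "x < b" using x by (cases "x = b") auto
    from nz cont x obtain d where "d > 0"
      and d: "\<And>c. c \<in> {a..b} \<Longrightarrow> dist c x < d \<Longrightarrow>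
        dist (integral {c..b} g) (integral {x..b} g) < \<bar>integral {x..b} g\<bar>"
      unfolding continuous_on_iff by (metis zero_less_abs_iff)
    obtain c where "c \<in> {x..min b (x + d/2)}" "integral {c..b} g = 0"
      using zero_between[of x "min b (x + d/2)"] x \<open>x < b\<close> \<open>d > 0\<close> by auto
    then show False using d[of c] x \<open>d > 0\<close> by (auto simp: dist_real_def)
  qed
qed

text \<open>
  The test functions \<open>\<psi>\<close> are the derivatives of the \<open>C\<^sup>1\<close> functions that vanish at both endpoints.
  A general continuous function is one of these plus a constant. If \<open>c\<close> is the mean value of
  \<open>h\<close>, then \<open>h - c\<close> is orthogonal to constants too, hence to all continuous functions.
\<close>

lemma du_Bois_Reymond:
  fixes h :: "real \<Rightarrow> real"
  assumes "a < b" and h: "h integrable_on {a..b}"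
    and orth: "\<And>\<psi>. continuous_on {a..b} \<psi> \<Longrightarrow> integral {a..b} \<psi> = 0 \<Longrightarrow>
      ((\<lambda>t. h t * \<psi> t) has_integral 0) {a..b}"
  shows "\<exists>c. negligible {t \<in> {a..b}. h t \<noteq> c}"
proof -
  define c where "c = integral {a..b} h / (b - a)"
  have "negligible {t \<in> {a..b}. h t - c \<noteq> 0}"
  proof (rule negligible_nonzero_if_orthogonal_to_continuous)
    show "(\<lambda>t. h t - c) integrable_on {a..b}"
      by (intro integrable_diff h integrable_const_ivl)
  next
    fix \<psi> :: "real \<Rightarrow> real" assume \<psi>: "continuous_on {a..b} \<psi>"
    define k where "k = integral {a..b} \<psi> / (b - a)"
    have \<psi>int: "(\<psi> has_integral k * (b - a)) {a..b}"
      using integrable_integral[OF integrable_continuous_real[OF \<psi>]] \<open>a < b\<close>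
      by (simp add: k_def)
    have const: "((\<lambda>t. k) has_integral k * (b - a)) {a..b}"
      using has_integral_const_real[of k a b] \<open>a < b\<close> by (simp add: mult.commute)
    have "((\<lambda>t. h t * (\<psi> t - k)) has_integral 0) {a..b}"
    proof (rule orth)
      show "continuous_on {a..b} (\<lambda>t. \<psi> t - k)"
        by (intro continuous_intros \<psi>)
      show "integral {a..b} (\<lambda>t. \<psi> t - k) = 0"
        using has_integral_diff[OF \<psi>int const] by (simp add: integral_unique)
    qed
    moreover have "(h has_integral c * (b - a)) {a..b}"
      using integrable_integral[OF h] \<open>a < b\<close> by (simp add: c_def)
    ultimately have "((\<lambda>t. h t * (\<psi> t - k) + k * h t - c * \<psi> t) has_integral
        0 + k * (c * (b - a)) - c * (k * (b - a))) {a..b}"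
      by (intro has_integral_diff has_integral_add has_integral_mult_right \<psi>int)
    then show "((\<lambda>t. \<psi> t * (h t - c)) has_integral 0) {a..b}"
      by (simp add: algebra_simps)
  qed
  then show ?thesis by (intro exI[of _ c]) simp
qed

section \<open>The core as a multiplicative linear functional\<close>

context
  fixes A :: fuzzy and m :: real
  assumes A: "fuzzy_number A" "asymmetric A" and m: "level A 1 = {m}"
begin

lemma lin_in_RF: "lin A r q \<in> RF A"
  by (auto simp: RF_def)

lemma RF_E:
  assumes "B \<in> RF A" obtains r q where "B = lin A r q"
  using assms by (auto simp: RF_def)

lemma fadd_lin: "lin A r q \<oplus>\<^bsub>A\<^esub> lin A r' q' = lin A (r + r') (q + q')"
  by (simp add: fadd_def rpart_lin[OF A] qpart_lin[OF A])

lemma fscale_lin: "c \<cdot>\<^bsub>A\<^esub> lin A r q = lin A (c * r) (c * q)"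
  by (simp add: fscale_def rpart_lin[OF A] qpart_lin[OF A])

lemma fminus_lin: "lin A r q \<ominus>\<^bsub>A\<^esub> lin A r' q' = lin A (r - r') (q - q')"
  by (simp add: fminus_def fscale_lin fadd_lin)

lemma core_lin_eq: "core (lin A r q) = r + q * m"
  by (rule core_lin[OF A(1) m])

lemma core_self: "core A = m"
  by (simp add: core_def m)

lemma fnorm_lin: "fnorm A (lin A r q) = \<bar>q\<bar> + \<bar>r + q * m\<bar>"
  by (simp add: fnorm_def rpart_lin[OF A] qpart_lin[OF A] core_self)

lemma core_fminus:
  assumes "B \<in> RF A" "C \<in> RF A"
  shows "core (B \<ominus>\<^bsub>A\<^esub> C) = core B - core C"
  using assms by (auto elim!: RF_E simp: fminus_lin core_lin_eq algebra_simps)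

lemma fminus_in_RF:
  assumes "B \<in> RF A" "C \<in> RF A"
  shows "B \<ominus>\<^bsub>A\<^esub> C \<in> RF A"
  using assms by (auto elim!: RF_E simp: fminus_lin lin_in_RF)

lemma cross_in_RF:
  assumes "B \<in> RF A" "C \<in> RF A"
  shows "B \<odot>\<^bsub>A\<^esub> C \<in> RF A"
  using assms by (auto elim!: RF_E simp: cross_lin[OF A m] lin_in_RF)

lemma core_cross:
  assumes "B \<in> RF A" "C \<in> RF A"
  shows "core (B \<odot>\<^bsub>A\<^esub> C) = core B * core C"
  using assms
  by (auto elim!: RF_E simp: cross_lin[OF A m] core_lin_eq)
     (simp add: algebra_simps power2_eq_square)

lemma abs_core_le_fnorm: "B \<in> RF A \<Longrightarrow> \<bar>core B\<bar> \<le> fnorm A B"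
  by (auto elim!: RF_E simp: fnorm_lin core_lin_eq)

text \<open>
  If \<open>B \<odot> B = 0\<close>, then \<open>(core B)\<^sup>2 = 0\<close> by multiplicativity. Conversely
  \<open>B \<odot> B = bB + bB - b\<^sup>2\<close> with \<open>b = core B\<close>, so that every term has a factor \<open>b\<close>.
\<close>

lemma mem_RF0_iff:
  assumes B: "B \<in> RF A"
  shows "B \<in> RF0 A \<longleftrightarrow> core B = 0"
proof
  assume "B \<in> RF0 A"
  then have "core B * core B = core (crisp A 0)"
    using core_cross[OF B B] by (simp add: RF0_def)
  then show "core B = 0" by (simp add: core_lin_eq)
next
  assume zero: "core B = 0"
  obtain r q where "B = lin A r q" using B by (rule RF_E)
  then have "B \<odot>\<^bsub>A\<^esub> B = crisp A 0"
    using zero by (simp add: cross_def fscale_lin fadd_lin)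
  then show "B \<in> RF0 A" using B by (simp add: RF0_def)
qed

lemma riemann_sum_in_RF: "finite p \<Longrightarrow> riemann_sum A f p \<in> RF A"
  by (simp add: riemann_sum_eq[OF A] lin_in_RF)

lemma core_riemann_sum:
  assumes "finite p" and f: "\<And>x K. (x, K) \<in> p \<Longrightarrow> f x \<in> RF A"
  shows "core (riemann_sum A f p) = (\<Sum>(x, K)\<in>p. measure lborel K * core (f x))"
proof -
  have "core B = rpart A B + qpart A B * m" if "B \<in> RF A" for B
    using that by (auto elim!: RF_E simp: core_lin_eq rpart_lin[OF A] qpart_lin[OF A])
  then have "(\<Sum>(x, K)\<in>p. measure lborel K * core (f x)) =
    (\<Sum>(x, K)\<in>p. measure lborel K * rpart A (f x) + measure lborel K * qpart A (f x) * m)"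
    using f by (intro sum.cong refl) (auto simp: algebra_simps)
  then show ?thesis
    using \<open>finite p\<close>
    by (simp add: riemann_sum_eq[OF A] core_lin_eq case_prod_unfold sum.distrib sum_distrib_right)
qed

text \<open>
  The core maps Riemann sums to Riemann sums and does not increase the norm. A
  uniform mesh bound \<open>d\<close> corresponds to the gauge of balls of radius \<open>d/3\<close>, because a set inside
  such a ball has diameter at most \<open>2d/3 < d\<close>.
\<close>

lemma has_integral_core:
  assumes f: "\<And>t. t \<in> {a..b} \<Longrightarrow> f t \<in> RF A"
    and I: "has_riemann_integral A a b f I"
  shows "((\<lambda>t. core (f t)) has_integral core I) {a..b}"
  unfolding has_integral_real
proof (intro allI impI)
  fix e :: real assume "e > 0"
  then obtain d where "d > 0"
    and d: "\<And>p. p tagged_division_of {a..b} \<Longrightarrow> \<forall>(x, K)\<in>p. diameter K < d \<Longrightarrow>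
      fnorm A (riemann_sum A f p \<ominus>\<^bsub>A\<^esub> I) < e"
    using I unfolding has_riemann_integral_def by metis
  have IRF: "I \<in> RF A" using I by (simp add: has_riemann_integral_def)
  show "\<exists>\<gamma>. gauge \<gamma> \<and> (\<forall>\<D>. \<D> tagged_division_of {a..b} \<and> \<gamma> fine \<D> \<longrightarrow>
      norm ((\<Sum>(x, K)\<in>\<D>. measure lborel K *\<^sub>R core (f x)) - core I) < e)"
  proof (intro exI conjI allI impI)
    show "gauge (\<lambda>x. ball x (d/3))" using \<open>d > 0\<close> by (intro gauge_ball) simp
  next
    fix p assume "p tagged_division_of {a..b} \<and> (\<lambda>x. ball x (d/3)) fine p"
    then have p: "p tagged_division_of {a..b}" and fine: "(\<lambda>x. ball x (d/3)) fine p" by auto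
    have fin: "finite p" using p by auto
    have "diameter K < d" if "(x, K) \<in> p" for x K
    proof -
      have "K \<subseteq> ball x (d/3)" using fine that by (auto simp: fine_def)
      then have "diameter K \<le> diameter (ball x (d/3))" by (intro diameter_subset) auto
      then show ?thesis using \<open>d > 0\<close> by simp
    qed
    then have close: "fnorm A (riemann_sum A f p \<ominus>\<^bsub>A\<^esub> I) < e" using d[OF p] by auto
    have "f x \<in> RF A" if "(x, K) \<in> p" for x K
      using tagged_division_ofD(2,3)[OF p that] by (intro f) auto
    then have "(\<Sum>(x, K)\<in>p. measure lborel K *\<^sub>R core (f x)) - core I =
        core (riemann_sum A f p \<ominus>\<^bsub>A\<^esub> I)"
      by (simp add: core_fminus[OF riemann_sum_in_RF[OF fin] IRF] core_riemann_sum[OF fin])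
    then show "norm ((\<Sum>(x, K)\<in>p. measure lborel K *\<^sub>R core (f x)) - core I) < e"
      using abs_core_le_fnorm[OF fminus_in_RF[OF riemann_sum_in_RF[OF fin] IRF], of f] close
      by simp
  qed
qed

section \<open>Crisp test functions\<close>

text \<open>
  The equivalence gives both existence and uniqueness of the derivative of a crisp function,
  and so determines the description operator in \<open>fderiv\<close>.
\<close>

lemma has_fderiv_crisp_iff:
  assumes "a < b" "t \<in> {a..b}"
    and \<phi>: "(\<phi> has_real_derivative \<phi>') (at t within {a..b})"
  shows "has_fderiv A {a..b} (\<lambda>s. crisp A (\<phi> s)) t D \<longleftrightarrow> D = crisp A \<phi>'"
proof (cases "D \<in> RF A")
  case False
  then show ?thesis using lin_in_RF by (auto simp: has_fderiv_def)
next
  case True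
  then obtain r q where D: "D = lin A r q" by (rule RF_E)
  have nontriv: "at t within {a..b} \<noteq> bot"
    using assms by (simp add: trivial_limit_within islimpt_Icc)
  define F where "F s = \<bar>- q\<bar> + \<bar>(\<phi> s - \<phi> t) / (s - t) - r + (- q) * m\<bar>" for s
  have quotient:
    "fnorm A ((1 / (s - t)) \<cdot>\<^bsub>A\<^esub> (crisp A (\<phi> s) \<ominus>\<^bsub>A\<^esub> crisp A (\<phi> t)) \<ominus>\<^bsub>A\<^esub> D) = F s" for s
    by (simp add: D fminus_lin fscale_lin fnorm_lin F_def)
  have lim: "(F \<longlongrightarrow> \<bar>- q\<bar> + \<bar>\<phi>' - r + (- q) * m\<bar>) (at t within {a..b})"
    using \<phi> unfolding F_def has_field_derivative_iff by (intro tendsto_intros)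
  have "has_fderiv A {a..b} (\<lambda>s. crisp A (\<phi> s)) t D \<longleftrightarrow> (F \<longlongrightarrow> 0) (at t within {a..b})"
    by (simp add: has_fderiv_def quotient True)
  also have "\<dots> \<longleftrightarrow> \<bar>- q\<bar> + \<bar>\<phi>' - r + (- q) * m\<bar> = 0"
  proof
    assume "(F \<longlongrightarrow> 0) (at t within {a..b})"
    with nontriv lim show "\<bar>- q\<bar> + \<bar>\<phi>' - r + (- q) * m\<bar> = 0" by (rule tendsto_unique)
  qed (use lim in metis)
  also have "\<dots> \<longleftrightarrow> q = 0 \<and> r = \<phi>'"
    by (cases "q = 0") (auto simp: add_nonneg_eq_0_iff)
  also have "\<dots> \<longleftrightarrow> D = crisp A \<phi>'" by (auto simp: D lin_inject[OF A])
  finally show ?thesis .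
qed

lemma fderiv_crisp:
  assumes "a < b" "t \<in> {a..b}" "(\<phi> has_real_derivative \<phi>') (at t within {a..b})"
  shows "fderiv A {a..b} (\<lambda>s. crisp A (\<phi> s)) t = crisp A \<phi>'"
  by (simp add: fderiv_def has_fderiv_crisp_iff[OF assms])

lemma crisp_in_C1:
  assumes "a < b" and \<phi>: "\<And>t. t \<in> {a..b} \<Longrightarrow> (\<phi> has_real_derivative \<psi> t) (at t within {a..b})"
    and \<psi>: "continuous_on {a..b} \<psi>"
  shows "(\<lambda>t. crisp A (\<phi> t)) \<in> C1 A a b"
proof -
  let ?D = "fderiv A {a..b} (\<lambda>t. crisp A (\<phi> t))"
  have D: "?D t = crisp A (\<psi> t)" if "t \<in> {a..b}" for t
    using that by (intro fderiv_crisp[OF \<open>a < b\<close> _ \<phi>])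
  have "fcontinuous_on A {a..b} ?D"
    unfolding fcontinuous_on_def
  proof
    fix t assume t: "t \<in> {a..b}"
    have "(\<psi> \<longlongrightarrow> \<psi> t) (at t within {a..b})"
      using \<psi> t by (simp add: continuous_on_def)
    then have "((\<lambda>s. \<bar>\<psi> s - \<psi> t\<bar>) \<longlongrightarrow> \<bar>\<psi> t - \<psi> t\<bar>) (at t within {a..b})"
      by (intro tendsto_intros)
    moreover have "\<forall>\<^sub>F s in at t within {a..b}.
        \<bar>\<psi> s - \<psi> t\<bar> = fnorm A (?D s \<ominus>\<^bsub>A\<^esub> ?D t)"
      using t by (auto simp: eventually_at_filter D fminus_lin fnorm_lin)
    ultimately show "((\<lambda>s. fnorm A (?D s \<ominus>\<^bsub>A\<^esub> ?D t)) \<longlongrightarrow> 0) (at t within {a..b})"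
      using Lim_transform_eventually by fastforce
  qed
  then show ?thesis
    unfolding C1_def using has_fderiv_crisp_iff[OF \<open>a < b\<close> _ \<phi>] lin_in_RF by blast
qed

text \<open>
  The test function is the crisp antiderivative \<open>\<eta> t = \<integral>\<^sub>a\<^sup>t \<psi>\<close>: the core of its derivative is \<open>\<psi>\<close>,
  and mean zero makes it vanish at \<open>b\<close>.
\<close>

lemma has_integral_core_times_mean_zero:
  assumes "a < b" and f: "\<And>t. t \<in> {a..b} \<Longrightarrow> f t \<in> RF A"
    and weak: "\<And>\<eta>. \<eta> \<in> C1 A a b \<Longrightarrow> \<eta> a = crisp A 0 \<Longrightarrow> \<eta> b = crisp A 0 \<Longrightarrow>
      has_riemann_integral A a b (\<lambda>t. f t \<odot>\<^bsub>A\<^esub> fderiv A {a..b} \<eta> t) (crisp A 0)"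
    and \<psi>: "continuous_on {a..b} \<psi>" "integral {a..b} \<psi> = 0"
  shows "((\<lambda>t. core (f t) * \<psi> t) has_integral 0) {a..b}"
proof -
  define \<eta> where "\<eta> t = crisp A (integral {a..t} \<psi>)" for t
  have deriv: "((\<lambda>t. integral {a..t} \<psi>) has_real_derivative \<psi> t) (at t within {a..b})"
    if "t \<in> {a..b}" for t
    using integral_has_real_derivative[OF \<psi>(1) that] .
  have D: "fderiv A {a..b} \<eta> t = crisp A (\<psi> t)" if "t \<in> {a..b}" for t
    unfolding \<eta>_def using \<open>a < b\<close> that deriv[OF that] by (rule fderiv_crisp)
  have "\<eta> \<in> C1 A a b"
    unfolding \<eta>_def using \<open>a < b\<close> deriv \<psi>(1) by (rule crisp_in_C1)
  moreover have "\<eta> a = crisp A 0" "\<eta> b = crisp A 0"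
    by (simp_all add: \<eta>_def \<psi>(2))
  ultimately have "has_riemann_integral A a b (\<lambda>t. f t \<odot>\<^bsub>A\<^esub> fderiv A {a..b} \<eta> t) (crisp A 0)"
    by (rule weak)
  then have "((\<lambda>t. core (f t \<odot>\<^bsub>A\<^esub> fderiv A {a..b} \<eta> t)) has_integral core (crisp A 0)) {a..b}"
    by (rule has_integral_core[rotated]) (simp add: D f cross_in_RF lin_in_RF)
  then have "((\<lambda>t. core (f t \<odot>\<^bsub>A\<^esub> fderiv A {a..b} \<eta> t)) has_integral 0) {a..b}"
    by (simp add: core_lin_eq)
  then show ?thesis
    by (rule has_integral_eq[rotated])
       (simp add: D core_cross[OF f lin_in_RF] core_lin_eq)
qed

end

section \<open>The fundamental lemma for the cross product\<close>

theorem lemma5: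
  fixes A :: fuzzy and a_m a b :: real and f :: "real \<Rightarrow> fuzzy"
  assumes "fuzzy_number A" and "asymmetric A" and "level A 1 = {a_m}" and "a < b"
    and "\<forall>t\<in>{a..b}. f t \<in> RF A"
    and "riemann_integrable A a b f"
    and "\<forall>\<eta>\<in>C1 A a b. \<eta> a = crisp A 0 \<and> \<eta> b = crisp A 0 \<longrightarrow>
           has_riemann_integral A a b (\<lambda>t. f t \<odot>\<^bsub>A\<^esub> fderiv A {a..b} \<eta> t) (crisp A 0)"
  shows "\<exists>u\<in>RF A. AE t in lebesgue. t \<in> {a..b} \<longrightarrow> f t \<ominus>\<^bsub>A\<^esub> u \<in> RF0 A"
proof -
  note A = assms(1-3)
  have f: "f t \<in> RF A" if "t \<in> {a..b}" for t using assms(5) that by blast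
  have "(\<lambda>t. core (f t)) integrable_on {a..b}"
    using assms(6) has_integral_core[OF A, of a b f, OF f]
    unfolding riemann_integrable_def integrable_on_def by blast
  then obtain c where c: "negligible {t \<in> {a..b}. core (f t) \<noteq> c}"
    using du_Bois_Reymond[OF assms(4), of "\<lambda>t. core (f t)"]
      has_integral_core_times_mean_zero[OF A assms(4), of f, OF f] assms(7) by blast
  \<comment> \<open>Only the core of \<open>u\<close> matters, so a crisp number suffices.\<close>
  define u where "u = crisp A c"
  have u: "u \<in> RF A" and core_u: "core u = c"
    by (simp_all add: u_def lin_in_RF[OF A] core_lin_eq[OF A])
  have "f t \<ominus>\<^bsub>A\<^esub> u \<in> RF0 A" if "t \<in> {a..b}" "core (f t) = c" for t
    using that f[of t] u core_u
    by (simp add: mem_RF0_iff[OF A] fminus_in_RF[OF A] core_fminus[OF A])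
  then have "{t \<in> space lebesgue. \<not> (t \<in> {a..b} \<longrightarrow> f t \<ominus>\<^bsub>A\<^esub> u \<in> RF0 A)}
      \<subseteq> {t \<in> {a..b}. core (f t) \<noteq> c}"
    by auto
  moreover have "{t \<in> {a..b}. core (f t) \<noteq> c} \<in> null_sets lebesgue"
    using c by (simp add: negligible_iff_null_sets)
  ultimately have "AE t in lebesgue. t \<in> {a..b} \<longrightarrow> f t \<ominus>\<^bsub>A\<^esub> u \<in> RF0 A"
    by (intro AE_I')
  with u show ?thesis by blast
qed

end
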